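(* Let $\Gamma$ be a connected finite simple graph and let $e=\{v,w\}$ be a fixed cycle-edge of $\Gamma$. The map $\mathcal{I}\colon \mathrm{Acyc}(\Gamma)\to \mathrm{Acyc}_{\le}(\Gamma)$ can be extended to a (well-defined) map $$\mathcal{I}^*\colon \mathrm{Acyc}(\Gamma)/\!\sim_\kappa\;\longrightarrow\;\mathrm{Acyc}_{\le}(\Gamma),\qquad \mathcal{I}^*([O_\Gamma])=\mathcal{I}(O^1_\Gamma),$$ where $O^1_\Gamma$ is any element of the $\kappa$-class $[O_\Gamma]$ for which $\mathcal{I}(O^1_\Gamma)\neq\varnothing$.
   Context: $\mathrm{v}[\Gamma]$ and $\mathrm{e}[\Gamma]$ denote the vertex and edge sets of $\Gamma$. A cycle-edge is an edge that is not a bridge, i.e. whose removal does not increase the number of connected components. $\mathrm{Acyc}(\Gamma)$ is the set of acyclic orientations of $\Gamma$. An acyclic orientation $O_\Gamma$ is viewed as a partial order on $\mathrm{v}[\Gamma]$: $a\le_{O_\Gamma} b$ iff there is a (possibly trivial) directed path from $a$ to $b$ in $O_\Gamma$. A click (source-to-sink operation) takes a vertex that is a source of an acyclic orientation and reverses all edges at it, so that it becomes a sink (the result is again acyclic). Two acyclic orientations are $\kappa$-equivalent, written $O_\Gamma\sim_\kappa O'_\Gamma$, if one can be transformed into the other by a finite sequence of clicks; this is an equivalence relation on $\mathrm{Acyc}(\Gamma)$, and $[O_\Gamma]$ denotes the equivalence class ($\kappa$-class) of $O_\Gamma$. $\mathrm{Acyc}_{\le}(\Gamma)$ is the set of acyclic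 orientations of vertex-induced subgraphs of $\Gamma$ (including the null graph $\varnothing$). The map $\mathcal{I}\colon\mathrm{Acyc}(\Gamma)\to\mathrm{Acyc}_{\le}(\Gamma)$ is defined as follows: if $v\le_{O_\Gamma} w$, then $\mathcal{I}(O_\Gamma)=[v,w]$, the subgraph of $\Gamma$ induced by all vertices lying on a directed path from $v$ to $w$ in $O_\Gamma$, with orientation inherited from $O_\Gamma$; otherwise $\mathcal{I}(O_\Gamma)=\varnothing$. *)

theory Defs
  imports
    "HOL-Library.FuncSet"
    "Graph_Theory.Pair_Digraph"
    "Graph_Theory.Digraph_Component"
begin

text \<open>
  A finite simple graph is a \<^locale>\<open>pair_graph\<close>: a finite, loop-free digraph without parallel
  arcs in which every undirected edge \<open>{a, b}\<close> is represented by the two arcs \<open>(a, b)\<close>, \<open>(b, a)\<close>.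
  Orientations of such a graph are digraphs containing exactly one of the two arcs.
\<close>

definition del_edge :: "'a pair_pre_digraph \<Rightarrow> 'a \<Rightarrow> 'a \<Rightarrow> 'a pair_pre_digraph" where
  "del_edge G a b = \<lparr>pverts = pverts G, parcs = parcs G - {(a, b), (b, a)}\<rparr>"

text \<open>
  The strongly connected components of a symmetric digraph are the connected components
  of the undirected graph it represents.
\<close>

definition num_components :: "'a pair_pre_digraph \<Rightarrow> nat" where
  "num_components G = card (pre_digraph.sccs (with_proj G))"

definition is_bridge :: "'a pair_pre_digraph \<Rightarrow> 'a \<Rightarrow> 'a \<Rightarrow> bool" where
  "is_bridge G a b \<longleftrightarrow>
     (a, b) \<in> parcs G \<and> num_components (del_edge G a b) > num_components G"

definition is_cycle_edge :: "'a pair_pre_digraph \<Rightarrow> 'a \<Rightarrow> 'a \<Rightarrow> bool" where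
  "is_cycle_edge G a b \<longleftrightarrow> (a, b) \<in> parcs G \<and> \<not> is_bridge G a b"

text \<open>
  Counterpart of \<^const>\<open>induce_subgraph\<close> that stays within \<^typ>\<open>'a pair_pre_digraph\<close>.
  On an orientation it yields the induced subgraph with the inherited orientation.
\<close>

definition pair_induce :: "'a pair_pre_digraph \<Rightarrow> 'a set \<Rightarrow> 'a pair_pre_digraph" where
  "pair_induce G S = \<lparr>pverts = S, parcs = {(a, b) \<in> parcs G. a \<in> S \<and> b \<in> S}\<rparr>"

lemma with_proj_pair_induce: "with_proj (pair_induce G S) = with_proj G \<restriction> S"
  by (auto simp: with_proj_def pair_induce_def induce_subgraph_def)

definition null_graph :: "'a pair_pre_digraph" where
  "null_graph = \<lparr>pverts = {}, parcs = {}\<rparr>"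

definition is_orientation :: "'a pair_pre_digraph \<Rightarrow> 'a pair_pre_digraph \<Rightarrow> bool" where
  "is_orientation G D \<longleftrightarrow>
     pverts D = pverts G \<and> parcs D \<subseteq> parcs G \<and>
     (\<forall>(a, b) \<in> parcs G. ((a, b) \<in> parcs D) \<noteq> ((b, a) \<in> parcs D))"

definition Acyc :: "'a pair_pre_digraph \<Rightarrow> 'a pair_pre_digraph set" where
  "Acyc G = {D. is_orientation G D \<and> acyclic (parcs D)}"

definition Acyc_le :: "'a pair_pre_digraph \<Rightarrow> 'a pair_pre_digraph set" where
  "Acyc_le G = (\<Union>S \<in> Pow (pverts G). Acyc (pair_induce G S))"

definition directed_path ::
  "'a pair_pre_digraph \<Rightarrow> 'a \<Rightarrow> ('a \<times> 'a) awalk \<Rightarrow> 'a \<Rightarrow> bool" where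
  "directed_path D = pre_digraph.apath (with_proj D)"

definition path_le :: "'a pair_pre_digraph \<Rightarrow> 'a \<Rightarrow> 'a \<Rightarrow> bool" where
  "path_le D a b \<longleftrightarrow> (\<exists>p. directed_path D a p b)"

definition interval :: "'a pair_pre_digraph \<Rightarrow> 'a \<Rightarrow> 'a \<Rightarrow> 'a pair_pre_digraph" where
  "interval D v w =
     pair_induce D {x. \<exists>p. directed_path D v p w \<and> x \<in> set (pawalk_verts v p)}"

definition interval_map :: "'a \<Rightarrow> 'a \<Rightarrow> 'a pair_pre_digraph \<Rightarrow> 'a pair_pre_digraph" where
  "interval_map v w D = (if path_le D v w then interval D v w else null_graph)"

definition is_source :: "'a pair_pre_digraph \<Rightarrow> 'a \<Rightarrow> bool" where
  "is_source D v \<longleftrightarrow> v \<in> pverts D \<and> (\<forall>u. (u, v) \<notin> parcs D)"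

definition click :: "'a \<Rightarrow> 'a pair_pre_digraph \<Rightarrow> 'a pair_pre_digraph" where
  "click v D = \<lparr>pverts = pverts D,
     parcs = (\<lambda>(a, b). if a = v \<or> b = v then (b, a) else (a, b)) ` parcs D\<rparr>"

definition click_rel :: "'a pair_pre_digraph \<Rightarrow> 'a pair_pre_digraph rel" where
  "click_rel G = {(D, click v D) |D v. D \<in> Acyc G \<and> is_source D v}"

definition kappa_rel :: "'a pair_pre_digraph \<Rightarrow> 'a pair_pre_digraph rel" where
  "kappa_rel G = (click_rel G)\<^sup>* \<inter> (Acyc G \<times> Acyc G)"

text \<open>
  The definition of \<^const>\<open>kappa_rel\<close> allows only source-to-sink moves, so its symmetry, on which
  the meaning of the quotient \<open>Acyc G // kappa_rel G\<close> depends, is not immediate. It holds because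
  clicking every vertex once, along a linear extension, restores the orientation.
\<close>

lemma in_parcs_click:
  "(a, b) \<in> parcs (click v D) \<longleftrightarrow> (if a = v \<or> b = v then (b, a) else (a, b)) \<in> parcs D"
  by (force simp: click_def image_iff split: if_splits)

lemma click_Acyc:
  assumes G: "pair_graph G" and D: "D \<in> Acyc G" and v: "is_source D v"
  shows "click v D \<in> Acyc G"
proof -
  interpret pair_graph G by (rule G)
  have "is_orientation G (click v D)"
    unfolding is_orientation_def
  proof (intro conjI)
    show "pverts (click v D) = pverts G"
      using D by (simp add: click_def Acyc_def is_orientation_def)
    show "parcs (click v D) \<subseteq> parcs G"
    proof (rule subrelI)
      fix a b assume "(a, b) \<in> parcs (click v D)"
      moreover have "parcs D \<subseteq> parcs G" using D by (simp add: Acyc_def is_orientation_def)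
      ultimately show "(a, b) \<in> parcs G"
        using arcs_symmetric by (auto simp: in_parcs_click split: if_splits)
    qed
    show "\<forall>(a, b)\<in>parcs G. ((a, b) \<in> parcs (click v D)) \<noteq> ((b, a) \<in> parcs (click v D))"
      using D by (auto simp: in_parcs_click Acyc_def is_orientation_def)
  qed
  moreover have "acyclic (parcs (click v D))"
  proof -
    have sink: "(v, b) \<notin> parcs (click v D)" for b
      using v by (simp add: in_parcs_click is_source_def)
    have step: "(a, b) \<in> (parcs D)\<^sup>+ \<or> b = v" if "(a, b) \<in> (parcs (click v D))\<^sup>+" for a b
      using that
    proof (induction rule: trancl_induct)
      case (base y)
      then show ?case using sink by (auto simp: in_parcs_click split: if_splits)
    next
      case (step y z)
      then have "y \<noteq> v" using sink by blast
      with step show ?case by (auto simp: in_parcs_click split: if_splits intro: trancl_into_trancl)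
    qed
    show ?thesis
      unfolding acyclic_def
    proof (intro allI notI)
      fix a assume a: "(a, a) \<in> (parcs (click v D))\<^sup>+"
      then have "a = v" using step[OF a] D by (auto simp: Acyc_def acyclic_def)
      with a sink show False by (meson tranclD)
    qed
  qed
  ultimately show ?thesis by (simp add: Acyc_def)
qed

lemma click_rel_reverse:
  assumes G: "pair_graph G" and D: "D \<in> Acyc G" and v: "is_source D v"
  shows "(click v D, D) \<in> (click_rel G)\<^sup>*"
proof -
  interpret pair_graph G by (rule G)
  define flip where "flip = (\<lambda>S. \<lparr>pverts = pverts D,
    parcs = {(a, b). (if (a \<in> S) = (b \<in> S) then (a, b) else (b, a)) \<in> parcs D}\<rparr>)"
  have V: "pverts D = pverts G" and sub: "parcs D \<subseteq> parcs G" and ac: "acyclic (parcs D)"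
    using D by (auto simp: Acyc_def is_orientation_def)
  have fin: "finite (parcs D)" using sub pair_finite_arcs by (rule finite_subset)
  have loop: "(a, a) \<notin> parcs D" for a using ac by (auto simp: acyclic_def)
  have ends: "a \<in> pverts G \<and> b \<in> pverts G" if "(a, b) \<in> parcs D" for a b
    using that sub in_arcsD1 in_arcsD2 by blast
  have click_flip: "click x (flip S) = flip (insert x S)" if "x \<notin> S" for x S
  proof (rule pair_pre_digraph.equality)
    show "parcs (click x (flip S)) = parcs (flip (insert x S))"
    proof (rule set_eqI, clarify)
      fix a b
      show "(a, b) \<in> parcs (click x (flip S)) \<longleftrightarrow> (a, b) \<in> parcs (flip (insert x S))"
        unfolding in_parcs_click using that loop by (auto simp: flip_def)
    qed
  qed (simp_all add: click_def flip_def)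
  have "(flip S, D) \<in> (click_rel G)\<^sup>*"
    if "S \<subseteq> pverts G" "\<forall>(a, b) \<in> parcs D. b \<in> S \<longrightarrow> a \<in> S" "flip S \<in> Acyc G" for S
    using that
  proof (induction "card (pverts G - S)" arbitrary: S rule: less_induct)
    case less
    show ?case
    proof (cases "pverts G - S = {}")
      case True
      then have "a \<in> S \<and> b \<in> S" if "(a, b) \<in> parcs D" for a b
        using ends[OF that] by blast
      then have "{(a, b). (if (a \<in> S) = (b \<in> S) then (a, b) else (b, a)) \<in> parcs D} = parcs D"
        by (auto split: if_splits)
      then have "flip S = D" by (simp add: flip_def)
      then show ?thesis by simp
    next
      case False
      have "wf (parcs D)" using fin ac by (simp add: finite_acyclic_wf)
      with False obtain x where x: "x \<in> pverts G - S"
        and min: "\<And>y. (y, x) \<in> parcs D \<Longrightarrow> y \<notin> pverts G - S"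
        by (metis ex_in_conv wfE_min)
      have "is_source (flip S) x"
        using x min less.prems(2) ends by (fastforce simp: is_source_def flip_def V split: if_splits)
      moreover have eq: "click x (flip S) = flip (insert x S)" using click_flip x by blast
      ultimately have step: "(flip S, flip (insert x S)) \<in> click_rel G"
        and acyc: "flip (insert x S) \<in> Acyc G"
        using less.prems(3) click_Acyc[OF G] by (force simp: click_rel_def, metis)
      have "card (pverts G - insert x S) < card (pverts G - S)"
        using x pair_finite_verts by (intro psubset_card_mono) auto
      moreover have "insert x S \<subseteq> pverts G" using x less.prems(1) by blast
      moreover have "\<forall>(a, b) \<in> parcs D. b \<in> insert x S \<longrightarrow> a \<in> insert x S"
        using less.prems(2) min ends by blast
      ultimately have "(flip (insert x S), D) \<in> (click_rel G)\<^sup>*"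
        using less.hyps acyc by blast
      with step show ?thesis by (rule converse_rtrancl_into_rtrancl)
    qed
  qed
  moreover have "click v D = flip {v}"
  proof -
    have "flip {} = D" by (auto simp: flip_def)
    with click_flip[of v "{}"] show ?thesis by simp
  qed
  ultimately show ?thesis
    using click_Acyc[OF G D v] v V by (auto simp: is_source_def)
qed

lemma equiv_kappa_rel:
  assumes G: "pair_graph G"
  shows "equiv (Acyc G) (kappa_rel G)"
proof (rule equivI)
  show "kappa_rel G \<subseteq> Acyc G \<times> Acyc G" by (auto simp: kappa_rel_def)
  show "refl_on (Acyc G) (kappa_rel G)" by (auto simp: kappa_rel_def refl_on_def)
  show "trans (kappa_rel G)" by (auto simp: kappa_rel_def trans_def)
  have "(E, D) \<in> (click_rel G)\<^sup>*" if "(D, E) \<in> (click_rel G)\<^sup>*" for D E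
    using that
  proof induction
    case (step y z)
    then have "(z, y) \<in> (click_rel G)\<^sup>*"
      using click_rel_reverse[OF G] by (auto simp: click_rel_def)
    with step.IH show ?case by (meson rtrancl_trans)
  qed simp
  then show "sym (kappa_rel G)" by (auto simp: kappa_rel_def sym_def)
qed

end

theory Submission
  imports Defs
begin

text \<open>
  An acyclic orientation has a nonempty interval exactly when the edge points from \<open>v\<close> to \<open>w\<close>.
  Clicking the vertices below \<open>w\<close>, sources first, produces such an orientation in every class.
  For uniqueness, let \<open>c x\<close> count the clicks at \<open>x\<close> in a sequence from \<open>D\<close> to \<open>D'\<close>. Along an arc
  \<open>(a, b)\<close> of \<open>D\<close> the difference \<open>c a - c b\<close> is \<open>0\<close> if the arc survives in \<open>D'\<close> and \<open>1\<close> if it is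
  reversed, so \<open>c\<close> is weakly decreasing along directed paths of \<open>D\<close>. If both orientations contain
  \<open>(v, w)\<close>, then \<open>c v = c w\<close>, hence \<open>c\<close> is constant on the interval of \<open>D\<close>, and all arcs of
  that interval survive.
\<close>

section \<open>Reachability and intervals in an orientation\<close>

lemma pair_wf_digraph_Acyc:
  assumes "pair_graph G" and "D \<in> Acyc G"
  shows "pair_wf_digraph D"
proof -
  interpret pair_graph G by fact
  show ?thesis
    using assms(2)
    by unfold_locales
      (auto simp: Acyc_def is_orientation_def dest!: subsetD dest: in_arcsD1 in_arcsD2)
qed

context pair_wf_digraph
begin

text \<open>Library reachability is relative to the vertex set, whereas the plain closure relates
  every element to itself; the two differ only in the trivial case \<open>a = b\<close>.\<close>

lemma reachable_iff_rtrancl: "reachable (with_proj G) a b \<longleftrightarrow> a \<in> pverts G \<and> (a, b) \<in> (parcs G)\<^sup>*"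
proof
  assume "reachable (with_proj G) a b"
  then show "a \<in> pverts G \<and> (a, b) \<in> (parcs G)\<^sup>*"
    using reachable_in_verts(1) by (auto simp: reachable_def intro: rtrancl_on_rtranclI)
next
  assume *: "a \<in> pverts G \<and> (a, b) \<in> (parcs G)\<^sup>*"
  show "reachable (with_proj G) a b"
  proof (cases "a = b")
    case True
    with * show ?thesis by simp
  next
    case False
    with * have "(a, b) \<in> (parcs G)\<^sup>+" by (simp add: rtrancl_eq_or_trancl)
    then show ?thesis by (simp add: reachable1_reachable)
  qed
qed

lemma path_le_iff: "path_le G a b \<longleftrightarrow> a \<in> pverts G \<and> (a, b) \<in> (parcs G)\<^sup>*"
  unfolding path_le_def directed_path_def reachable_iff_rtrancl[symmetric] reachable_apath ..

text \<open>A repeated vertex would split off a closed walk, hence a cycle. This makes concatenated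
  walks paths again, so that intervals can be described by reachability alone.\<close>

lemma acyclic_awalk_apath:
  assumes "acyclic (parcs G)" and "awalk u p v"
  shows "apath u p v"
proof (rule ccontr)
  assume "\<not> apath u p v"
  with assms(2) have "\<not> distinct (pawalk_verts u p)" by (simp add: apath_def)
  with assms(2) obtain r where "closed_w r" by (rule awalk_cyc_decompE')
  then obtain x where "(x, x) \<in> (parcs G)\<^sup>+"
    unfolding closed_w_def using reachable1_awalkI by blast
  with assms(1) show False by (simp add: acyclic_def)
qed

lemma interval_verts:
  assumes "acyclic (parcs G)" and "v \<in> pverts G"
  shows "pverts (interval G v w) = {x. (v, x) \<in> (parcs G)\<^sup>* \<and> (x, w) \<in> (parcs G)\<^sup>*}"
proof (rule set_eqI)
  fix x
  have "(\<exists>p. apath v p w \<and> x \<in> set (pawalk_verts v p)) \<longleftrightarrow>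
    reachable (with_proj G) v x \<and> reachable (with_proj G) x w"
  proof
    assume "\<exists>p. apath v p w \<and> x \<in> set (pawalk_verts v p)"
    then show "reachable (with_proj G) v x \<and> reachable (with_proj G) x w"
      using awalkI_apath awalk_verts_reachable_from awalk_verts_reachable_to by blast
  next
    assume "reachable (with_proj G) v x \<and> reachable (with_proj G) x w"
    then obtain p q where pq: "awalk v p x" "awalk x q w"
      by (auto simp: reachable_awalk)
    then have "awalk v (p @ q) w" by (rule awalk_appendI)
    then have "apath v (p @ q) w" by (rule acyclic_awalk_apath[OF assms(1)])
    moreover have "x \<in> set (pawalk_verts v (p @ q))"
      using set_awalk_verts_append[OF pq] hd_in_awalk_verts(1)[OF pq(2)] by simp
    ultimately show "\<exists>p. apath v p w \<and> x \<in> set (pawalk_verts v p)" by blast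
  qed
  also have "\<dots> \<longleftrightarrow> (v, x) \<in> (parcs G)\<^sup>* \<and> (x, w) \<in> (parcs G)\<^sup>*"
    using assms(2) reachable_in_verts(2) by (auto simp: reachable_iff_rtrancl)
  finally show "x \<in> pverts (interval G v w) \<longleftrightarrow> x \<in> {x. (v, x) \<in> (parcs G)\<^sup>* \<and> (x, w) \<in> (parcs G)\<^sup>*}"
    by (simp add: interval_def pair_induce_def directed_path_def)
qed

lemma interval_verts_subset: "pverts (interval G v w) \<subseteq> pverts G"
  unfolding interval_def pair_induce_def directed_path_def apath_def
  by (auto dest: awalk_verts_in_verts awalk_hd_in_verts)

end

lemma interval_map_in_Acyc_le:
  assumes "pair_graph G" and D: "D \<in> Acyc G"
  shows "interval_map v w D \<in> Acyc_le G"
proof -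
  have induce: "pair_induce D S \<in> Acyc_le G" if "S \<subseteq> pverts G" for S
  proof -
    have "acyclic (parcs (pair_induce D S))"
      using D by (auto simp: Acyc_def pair_induce_def elim: acyclic_subset)
    moreover have "is_orientation (pair_induce G S) (pair_induce D S)"
      using D by (auto simp: Acyc_def pair_induce_def is_orientation_def)
    ultimately show ?thesis using that by (auto simp: Acyc_le_def Acyc_def)
  qed
  show ?thesis
  proof (cases "path_le D v w")
    case True
    have "pverts (interval D v w) \<subseteq> pverts G"
      using pair_wf_digraph.interval_verts_subset[OF pair_wf_digraph_Acyc[OF assms]] D
      by (fastforce simp: Acyc_def is_orientation_def)
    then have "interval D v w \<in> Acyc_le G"
      using induce[of "pverts (interval D v w)"] by (simp add: interval_def pair_induce_def)
    with True show ?thesis by (simp add: interval_map_def)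
  next
    case False
    have "null_graph = pair_induce D {}" by (simp add: null_graph_def pair_induce_def)
    with False induce[of "{}"] show ?thesis by (simp add: interval_map_def)
  qed
qed

section \<open>Orientations containing the arc \<open>(v, w)\<close>, and reaching one by
  clicks\<close>

text \<open>A directed path from \<open>v\<close> to \<open>w\<close> together with the arc
  \<open>(w, v)\<close> would close a cycle; conversely, the arc \<open>(v, w)\<close> puts
  \<open>v\<close> itself into the interval.\<close>

lemma interval_map_nonnull_iff:
  assumes G: "pair_graph G" and D: "D \<in> Acyc G" and vw: "(v, w) \<in> parcs G"
  shows "interval_map v w D \<noteq> null_graph \<longleftrightarrow> (v, w) \<in> parcs D"
proof -
  interpret G: pair_graph G by (rule G)
  interpret D: pair_wf_digraph D using G D by (rule pair_wf_digraph_Acyc)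
  have ac: "acyclic (parcs D)" and v: "v \<in> pverts D"
    using D vw G.in_arcsD1 by (auto simp: Acyc_def is_orientation_def)
  have or: "(v, w) \<in> parcs D \<or> (w, v) \<in> parcs D"
    using D vw by (auto simp: Acyc_def is_orientation_def)
  show ?thesis
  proof
    assume "interval_map v w D \<noteq> null_graph"
    then have "(v, w) \<in> (parcs D)\<^sup>*"
      by (auto simp: interval_map_def D.path_le_iff split: if_splits)
    then have "(w, v) \<notin> parcs D"
      using ac by (meson acyclic_def rtrancl_into_trancl2)
    with or show "(v, w) \<in> parcs D" by blast
  next
    assume vwD: "(v, w) \<in> parcs D"
    then have "v \<in> pverts (interval D v w)"
      using D.interval_verts[OF ac v] by auto
    moreover have "path_le D v w" using v vwD by (auto simp: D.path_le_iff)
    ultimately show "interval_map v w D \<noteq> null_graph"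
      by (auto simp: interval_map_def null_graph_def)
  qed
qed

text \<open>Induction on the number of vertices that reach \<open>w\<close>: clicking a source other
  than \<open>w\<close> among them removes it from this set and adds nothing.\<close>

lemma clicks_reach_arc:
  assumes G: "pair_graph G" and D: "D \<in> Acyc G" and vw: "(v, w) \<in> parcs G"
  shows "\<exists>E. (D, E) \<in> (click_rel G)\<^sup>* \<and> E \<in> Acyc G \<and> (v, w) \<in> parcs E"
  using D
proof (induction "card {x. (x, w) \<in> (parcs D)\<^sup>*}" arbitrary: D rule: less_induct)
  case less
  interpret G: pair_graph G by (rule G)
  interpret D: pair_wf_digraph D using G less.prems by (rule pair_wf_digraph_Acyc)
  have V: "pverts D = pverts G" and sub: "parcs D \<subseteq> parcs G" and ac: "acyclic (parcs D)"
    using less.prems by (auto simp: Acyc_def is_orientation_def)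
  show ?case
  proof (cases "(v, w) \<in> parcs D")
    case True
    with less.prems show ?thesis by blast
  next
    case False
    then have wv: "(w, v) \<in> parcs D"
      using vw less.prems by (auto simp: Acyc_def is_orientation_def)
    \<comment> \<open>A minimal vertex \<open>s\<close> among those reaching \<open>w\<close> is a
      source of \<open>D\<close>, since any predecessor of \<open>s\<close> would reach
      \<open>w\<close> as well.\<close>
    have "wf (parcs D)"
      using finite_subset[OF sub G.pair_finite_arcs] ac by (simp add: finite_acyclic_wf)
    then obtain s where s: "(s, w) \<in> (parcs D)\<^sup>*"
      and min: "\<And>y. (y, s) \<in> parcs D \<Longrightarrow> (y, w) \<notin> (parcs D)\<^sup>*"
      using wfE_min[of "parcs D" w "{x. (x, w) \<in> (parcs D)\<^sup>*}"] by auto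
    have below: "{x. (x, w) \<in> (parcs D)\<^sup>*} \<subseteq> pverts G"
      using vw G.in_arcsD2 by (auto elim: converse_rtranclE simp: V[symmetric] dest: D.in_arcsD1)
    have src: "is_source D s"
      using s min below by (auto simp: is_source_def V intro: converse_rtrancl_into_rtrancl)
    have step: "(D, click s D) \<in> click_rel G" and acyc: "click s D \<in> Acyc G"
      using less.prems src click_Acyc[OF G] by (auto simp: click_rel_def)
    show ?thesis
    proof (cases "s = w")
      case True
      then have "(v, w) \<in> parcs (click s D)" using wv by (simp add: in_parcs_click)
      with step acyc show ?thesis by blast
    next
      case False
      \<comment> \<open>Every reversed arc now ends in the sink \<open>s\<close>, so a path to
        \<open>w\<close>, which differs from \<open>s\<close>, avoids \<open>s\<close> and uses old
        arcs only.\<close>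
      have "x \<noteq> s \<and> (x, w) \<in> (parcs D)\<^sup>*" if "(x, w) \<in> (parcs (click s D))\<^sup>*" for x
        using that
      proof (induction rule: converse_rtrancl_induct)
        case base
        with False show ?case by simp
      next
        case (step y z)
        with src show ?case
          by (auto simp: in_parcs_click is_source_def split: if_splits
              intro: converse_rtrancl_into_rtrancl)
      qed
      with s have "{x. (x, w) \<in> (parcs (click s D))\<^sup>*} \<subset> {x. (x, w) \<in> (parcs D)\<^sup>*}"
        by blast
      then have "card {x. (x, w) \<in> (parcs (click s D))\<^sup>*} < card {x. (x, w) \<in> (parcs D)\<^sup>*}"
        using finite_subset[OF below G.pair_finite_verts] by (rule psubset_card_mono[rotated])
      from less.hyps[OF this acyc] step show ?thesis
        by (meson converse_rtrancl_into_rtrancl)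
    qed
  qed
qed

section \<open>Click counts and invariance of the interval\<close>

text \<open>The two cases alternate: while the arc survives, only its tail can be a source, and a
  click there reverses it and raises the difference to 1; while it is reversed, only its old head
  can be a source, and a click there restores both.\<close>

lemma click_potential:
  assumes "(D, E) \<in> (click_rel G)\<^sup>*" and "acyclic (parcs D)"
  obtains c :: "'a \<Rightarrow> nat"
  where "\<And>a b. (a, b) \<in> parcs D \<Longrightarrow>
    (c a = c b \<and> (a, b) \<in> parcs E) \<or> (c a = Suc (c b) \<and> (b, a) \<in> parcs E)"
proof -
  have "\<exists>c :: 'a \<Rightarrow> nat. \<forall>a b. (a, b) \<in> parcs D \<longrightarrow>
    (c a = c b \<and> (a, b) \<in> parcs E) \<or> (c a = Suc (c b) \<and> (b, a) \<in> parcs E)"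
    using assms(1)
  proof induction
    case base
    show ?case by (rule exI[of _ "\<lambda>_. 0"]) simp
  next
    case (step E F)
    then obtain c s where c: "\<And>a b. (a, b) \<in> parcs D \<Longrightarrow>
        (c a = c b \<and> (a, b) \<in> parcs E) \<or> (c a = Suc (c b) \<and> (b, a) \<in> parcs E)"
      and s: "is_source E s" and F: "F = click s E"
      by (auto simp: click_rel_def)
    define c' where "c' = c(s := Suc (c s))"
    have "(c' a = c' b \<and> (a, b) \<in> parcs F) \<or> (c' a = Suc (c' b) \<and> (b, a) \<in> parcs F)"
      if ab: "(a, b) \<in> parcs D" for a b
    proof -
      \<comment> \<open>Distinct ends ensure that one click changes the count at no more than one of
        them.\<close>
      have "a \<noteq> b" using ab assms(2) by (auto simp: acyclic_def)
      with c[OF ab] s show ?thesis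
        unfolding F in_parcs_click is_source_def c'_def by auto
    qed
    then show ?case by blast
  qed
  then show ?thesis using that by blast
qed

lemma kappa_interval_arcs:
  assumes G: "pair_graph G" and DE: "(D, E) \<in> kappa_rel G"
    and vwD: "(v, w) \<in> parcs D" and vwE: "(v, w) \<in> parcs E"
    and a: "(v, a) \<in> (parcs D)\<^sup>*" and ab: "(a, b) \<in> parcs D" and b: "(b, w) \<in> (parcs D)\<^sup>*"
  shows "(a, b) \<in> parcs E"
proof -
  have D: "D \<in> Acyc G" and E: "E \<in> Acyc G" and "(D, E) \<in> (click_rel G)\<^sup>*"
    using DE by (auto simp: kappa_rel_def)
  then obtain c :: "'a \<Rightarrow> nat" where c: "\<And>a b. (a, b) \<in> parcs D \<Longrightarrow>
      (c a = c b \<and> (a, b) \<in> parcs E) \<or> (c a = Suc (c b) \<and> (b, a) \<in> parcs E)"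
    by (elim click_potential) (auto simp: Acyc_def)
  have mono: "c y \<le> c x" if "(x, y) \<in> (parcs D)\<^sup>*" for x y
    using that by induction (use c in fastforce)+
  have "(w, v) \<notin> parcs E"
    using vwE E by (auto simp: Acyc_def acyclic_def dest: trancl_into_trancl2)
  then have "c v = c w" using c[OF vwD] by blast
  \<comment> \<open>The chain \<open>c v >= c a >= c b >= c w = c v\<close> collapses, which
    excludes the reversed case for \<open>(a, b)\<close>.\<close>
  then have "c a = c b" using mono[OF a] mono[OF b] mono[OF r_into_rtrancl[OF ab]] by simp
  then show ?thesis using c[OF ab] by simp
qed

text \<open>Every vertex on a path from \<open>v\<close> to \<open>x\<close> still reaches
  \<open>w\<close> through \<open>x\<close>, and dually for paths from \<open>x\<close> to
  \<open>w\<close>; hence all arcs of these paths lie in the interval and survive.\<close>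

lemma kappa_interval_rtrancl:
  assumes G: "pair_graph G" and DE: "(D, E) \<in> kappa_rel G"
    and vwD: "(v, w) \<in> parcs D" and vwE: "(v, w) \<in> parcs E"
    and x: "(v, x) \<in> (parcs D)\<^sup>*" "(x, w) \<in> (parcs D)\<^sup>*"
  shows "(v, x) \<in> (parcs E)\<^sup>* \<and> (x, w) \<in> (parcs E)\<^sup>*"
proof
  note arc = kappa_interval_arcs[OF G DE vwD vwE]
  show "(v, x) \<in> (parcs E)\<^sup>*"
    using x
  proof (induction rule: rtrancl_induct)
    case (step y z)
    then have "(y, z) \<in> parcs E" "(y, w) \<in> (parcs D)\<^sup>*"
      by (auto intro: arc converse_rtrancl_into_rtrancl)
    with step.IH show ?case by (meson rtrancl_into_rtrancl)
  qed simp
  show "(x, w) \<in> (parcs E)\<^sup>*"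
    \<comment> \<open>The rule consumes the first fact; the other one is carried through the
      induction as a premise. The swap lets the path from \<open>x\<close> to \<open>w\<close> be
      the one inducted on.\<close>
    using x(2,1)
  proof (induction rule: converse_rtrancl_induct)
    case (step y z)
    then have "(y, z) \<in> parcs E" "(v, z) \<in> (parcs D)\<^sup>*"
      by (auto intro: arc rtrancl_into_rtrancl)
    with step.IH show ?case by (meson converse_rtrancl_into_rtrancl)
  qed simp
qed

lemma kappa_interval_map_eq:
  assumes G: "pair_graph G" and vw: "(v, w) \<in> parcs G" and DE: "(D, E) \<in> kappa_rel G"
    and D0: "interval_map v w D \<noteq> null_graph" and E0: "interval_map v w E \<noteq> null_graph"
  shows "interval_map v w D = interval_map v w E"
proof -
  \<comment> \<open>Survival of vertices and arcs gives only one inclusion; symmetry supplies the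
    other.\<close>
  have ED: "(E, D) \<in> kappa_rel G"
    using DE equiv_kappa_rel[OF G] by (meson equivE symE)
  have D: "D \<in> Acyc G" and E: "E \<in> Acyc G"
    using DE by (auto simp: kappa_rel_def)
  interpret G: pair_graph G by (rule G)
  interpret D: pair_wf_digraph D using G D by (rule pair_wf_digraph_Acyc)
  interpret E: pair_wf_digraph E using G E by (rule pair_wf_digraph_Acyc)
  have vwD: "(v, w) \<in> parcs D" and vwE: "(v, w) \<in> parcs E"
    using D0 E0 interval_map_nonnull_iff[OF G _ vw] D E by auto
  have verts: "pverts (interval D v w) = {x. (v, x) \<in> (parcs D)\<^sup>* \<and> (x, w) \<in> (parcs D)\<^sup>*}"
    "pverts (interval E v w) = {x. (v, x) \<in> (parcs E)\<^sup>* \<and> (x, w) \<in> (parcs E)\<^sup>*}"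
    using D E vwD vwE D.in_arcsD1 E.in_arcsD1
    by (intro D.interval_verts E.interval_verts; auto simp: Acyc_def)+
  have eq: "pverts (interval D v w) = pverts (interval E v w)"
    unfolding verts
    using kappa_interval_rtrancl[OF G DE vwD vwE] kappa_interval_rtrancl[OF G ED vwE vwD] by blast
  have "interval D v w = interval E v w"
  proof (rule pair_pre_digraph.equality)
    have induce: "parcs (interval F v w) =
        {(a, b) \<in> parcs F. a \<in> pverts (interval F v w) \<and> b \<in> pverts (interval F v w)}" for F
      by (simp add: interval_def pair_induce_def)
    show "parcs (interval D v w) = parcs (interval E v w)"
      unfolding induce eq
      using kappa_interval_arcs[OF G DE vwD vwE] kappa_interval_arcs[OF G ED vwE vwD]
        verts eq by blast
  qed (simp_all add: eq)
  with D0 E0 show ?thesis by (simp add: interval_map_def split: if_splits)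
qed

section \<open>The induced map on the classes\<close>

theorem proposition3p3:
  fixes G :: "'a pair_pre_digraph" and v w :: 'a
  assumes "pair_graph G"
    and "connected (with_proj G)"
    and "is_cycle_edge G v w"
  shows "(\<forall>C \<in> Acyc G // kappa_rel G. \<exists>D1 \<in> C. interval_map v w D1 \<noteq> null_graph) \<and>
    (\<exists>!Istar. Istar \<in> (Acyc G // kappa_rel G) \<rightarrow>\<^sub>E Acyc_le G \<and>
      (\<forall>D \<in> Acyc G. \<forall>D1 \<in> kappa_rel G `` {D}.
         interval_map v w D1 \<noteq> null_graph \<longrightarrow>
         Istar (kappa_rel G `` {D}) = interval_map v w D1))"
proof (rule conjI)
  let ?Q = "Acyc G // kappa_rel G"
  have vw: "(v, w) \<in> parcs G" using assms(3) by (simp add: is_cycle_edge_def)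
  have equiv: "equiv (Acyc G) (kappa_rel G)" using assms(1) by (rule equiv_kappa_rel)
  show ex: "\<forall>C \<in> ?Q. \<exists>D1 \<in> C. interval_map v w D1 \<noteq> null_graph"
  proof
    fix C assume "C \<in> ?Q"
    then obtain D where D: "D \<in> Acyc G" and C: "C = kappa_rel G `` {D}" by (rule quotientE)
    obtain E where "(D, E) \<in> (click_rel G)\<^sup>*" and E: "E \<in> Acyc G" "(v, w) \<in> parcs E"
      using clicks_reach_arc[OF assms(1) D vw] by blast
    then have "E \<in> C" using D by (simp add: C kappa_rel_def)
    with E show "\<exists>D1 \<in> C. interval_map v w D1 \<noteq> null_graph"
      using interval_map_nonnull_iff[OF assms(1) _ vw] by blast
  qed
  \<comment> \<open>An arbitrary representative with nonempty interval; by
    \<open>kappa_interval_map_eq\<close> the value at a class does not depend on this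
    choice.\<close>
  define rep where "rep C = (SOME D1. D1 \<in> C \<and> interval_map v w D1 \<noteq> null_graph)" for C
  have rep: "rep C \<in> C" "interval_map v w (rep C) \<noteq> null_graph" if "C \<in> ?Q" for C
    using someI_ex[of "\<lambda>D1. D1 \<in> C \<and> interval_map v w D1 \<noteq> null_graph"] ex that
    by (auto simp: rep_def Bex_def)
  show "\<exists>!Istar. Istar \<in> ?Q \<rightarrow>\<^sub>E Acyc_le G \<and>
      (\<forall>D \<in> Acyc G. \<forall>D1 \<in> kappa_rel G `` {D}.
         interval_map v w D1 \<noteq> null_graph \<longrightarrow>
         Istar (kappa_rel G `` {D}) = interval_map v w D1)"
  proof (rule ex1I, intro conjI ballI impI)
    show "restrict (\<lambda>C. interval_map v w (rep C)) ?Q \<in> ?Q \<rightarrow>\<^sub>E Acyc_le G"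
    proof (rule restrict_PiE_iff[THEN iffD2], rule ballI)
      fix C assume C: "C \<in> ?Q"
      then have "C \<subseteq> Acyc G" using equiv by (simp add: in_quotient_imp_subset)
      with rep(1)[OF C] show "interval_map v w (rep C) \<in> Acyc_le G"
        using interval_map_in_Acyc_le[OF assms(1)] by blast
    qed
  next
    fix D D1 assume D: "D \<in> Acyc G" and D1: "D1 \<in> kappa_rel G `` {D}"
      "interval_map v w D1 \<noteq> null_graph"
    have C: "kappa_rel G `` {D} \<in> ?Q" using D by (rule quotientI)
    then have "(rep (kappa_rel G `` {D}), D1) \<in> kappa_rel G"
      using quotient_eq_iff[OF equiv C C rep(1)[OF C] D1(1)] by simp
    with kappa_interval_map_eq[OF assms(1) vw _ rep(2)[OF C] D1(2)] C
    show "restrict (\<lambda>C. interval_map v w (rep C)) ?Q (kappa_rel G `` {D}) = interval_map v w D1"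
      by simp
  next
    fix J assume J: "J \<in> ?Q \<rightarrow>\<^sub>E Acyc_le G \<and>
      (\<forall>D \<in> Acyc G. \<forall>D1 \<in> kappa_rel G `` {D}.
         interval_map v w D1 \<noteq> null_graph \<longrightarrow>
         J (kappa_rel G `` {D}) = interval_map v w D1)"
    show "J = restrict (\<lambda>C. interval_map v w (rep C)) ?Q"
    proof
      fix C
      show "J C = restrict (\<lambda>C. interval_map v w (rep C)) ?Q C"
      \<comment> \<open>On a class, the defining condition applied to \<open>rep C\<close> forces
        the value; elsewhere both functions are \<open>undefined\<close>, because the function space
        is extensional.\<close>
      proof (cases "C \<in> ?Q")
        case True
        then obtain D where D: "D \<in> Acyc G" "C = kappa_rel G `` {D}" by (rule quotientE)
        with J rep[OF True] True show ?thesis by simp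
      next
        case False
        then show ?thesis using PiE_arb[OF J[THEN conjunct1] False] by simp
      qed
    qed
  qed
qed

end
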